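(* Let $\mathcal{H}_1,\mathcal{H}_2$ be Hilbert spaces over $\mathbb{F}=\mathbb{R}$ or $\mathbb{F}=\mathbb{C}$, let $K$ be a positive integer, and let $\{A_k\}_{k=1}^{K}\subset \mathcal{BC}(\mathcal{H}_1,\mathcal{H}_2)$. Assume that $\mathrm{R}(A_k)\subseteq \mathrm{N}(A_{k'}^{*})$ and $\mathrm{R}(A_k^{*})\subseteq \mathrm{N}(A_{k'})$ for each $k,k'=1,\ldots,K$, $k\neq k'$. Then $\left(\sum_{k=1}^{K}A_k\right)^{\dagger}$ is a $\{1,3,4\}$-inverse of $A_{k_0}$ for each $k_0=1,\ldots,K$.
   Context: $\mathcal{B}(\mathcal{H}_1,\mathcal{H}_2)$ is the set of bounded linear operators from $\mathcal{H}_1$ to $\mathcal{H}_2$, and $\mathcal{BC}(\mathcal{H}_1,\mathcal{H}_2)$ the subset of those with closed range. $A^{*}$, $\mathrm{N}(A)$, $\mathrm{R}(A)$ denote the adjoint, null space and range of $A$. For $A\in\mathcal{BC}(\mathcal{H}_1,\mathcal{H}_2)$ consider the equations (1) $AXA=A$, (2) $XAX=X$, (3) $(AX)^{*}=AX$, (4) $(XA)^{*}=XA$. The Moore--Penrose inverse $A^{\dagger}$ is the unique solution $X\in\mathcal{BC}(\mathcal{H}_2,\mathcal{H}_1)$ of (1)--(4). A $\{1,3,4\}$-inverse of $A$ is any $X\in\mathcal{B}(\mathcal{H}_2,\mathcal{H}_1)$ satisfying (1), (3) and (4). A bounded operator has a Moore--Penrose inverse if and only if its range is closed; the existence of $\left(\sum_{k=1}^{K}A_k\right)^{\dagger}$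 is part of the assertion. *)

theory Defs
  imports "HOL-Analysis.Analysis"
begin

text \<open>
  The scalar field is \<open>\<real>\<close> or \<open>\<complex>\<close>, treated uniformly through a class. The two
  axioms on \<open>conjg\<close> leave no other models: see \<open>real_or_complex_cases\<close> below.
\<close>

class real_or_complex = real_normed_field +
  fixes conjg :: "'a \<Rightarrow> 'a"
  assumes conjg_add: "conjg (x + y) = conjg x + conjg y"
    and mult_conjg_scaleR: "x * conjg x = (norm x)\<^sup>2 *\<^sub>R 1"

lemma mult_conjg: "x * conjg x = of_real ((norm x)\<^sup>2)" for x :: "'f::real_or_complex"
  unfolding of_real_def by (rule mult_conjg_scaleR)

instantiation real :: real_or_complex
begin
definition conjg_real :: "real \<Rightarrow> real" where "conjg_real x = x"
instance by standard (simp_all add: conjg_real_def power2_eq_square)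
end

instantiation complex :: real_or_complex
begin
definition conjg_complex :: "complex \<Rightarrow> complex" where "conjg_complex = cnj"
instance
  by standard
    (simp_all add: conjg_complex_def scaleR_conv_of_real complex_norm_square[symmetric]
      del: of_real_power)
end

lemma real_or_complex_quadratic:
  fixes x :: "'f::real_or_complex"
  assumes "x \<notin> \<real>"
  obtains a b i where "x = of_real a + of_real b * i" "i * i = -1" "b \<noteq> 0"
proof -
  have one: "conjg (1::'f) = 1"
    using mult_conjg[of "1::'f"] by simp
  define s where "s = (norm (x + 1))\<^sup>2 - (norm x)\<^sup>2 - 1"
  define n where "n = (norm x)\<^sup>2"
  have "(x + 1) * (conjg x + 1) = of_real ((norm (x + 1))\<^sup>2)"
    using mult_conjg[of "x + 1"] by (simp add: conjg_add one)
  moreover have p: "x * conjg x = of_real n"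
    unfolding n_def by (rule mult_conjg)
  ultimately have s: "x + conjg x = of_real s"
    by (simp add: s_def n_def algebra_simps)
  define a where "a = s / 2"
  have sa: "of_real s = 2 * (of_real a :: 'f)"
    by (simp add: a_def)
  have c: "conjg x = 2 * of_real a - x"
    using s sa by (simp add: algebra_simps)
  have sq: "(x - of_real a) * (x - of_real a) = of_real (a * a - n)"
    using p unfolding c by (simp add: algebra_simps)
  have neg: "n - a * a > 0"
  proof (rule ccontr)
    assume "\<not> ?thesis"
    then obtain r where r: "a * a - n = r * r"
      by (metis diff_ge_0_iff_ge linorder_not_less diff_gt_0_iff_gt real_sqrt_mult_self abs_of_nonneg)
    have "(x - of_real a) * (x - of_real a) = of_real r * of_real r"
      using sq unfolding r by simp
    then have "x - of_real a = of_real r \<or> x - of_real a = - of_real r"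
      by (simp add: square_eq_iff)
    then have "x = of_real (a + r) \<or> x = of_real (a - r)"
      by (auto simp: algebra_simps)
    then show False
      using assms by auto
  qed
  define b where "b = sqrt (n - a * a)"
  have b: "b \<noteq> 0" "b * b = n - a * a"
    using neg by (auto simp: b_def)
  define i where "i = (x - of_real a) / of_real b"
  have "i * i = of_real (a * a - n) / of_real (b * b)"
    using sq by (simp add: i_def)
  also have "\<dots> = of_real ((a * a - n) / (b * b))"
    by (simp only: of_real_divide)
  also have "(a * a - n) / (b * b) = -1"
    using neg b by (simp add: field_simps)
  finally have "i * i = -1"
    by simp
  moreover have "x = of_real a + of_real b * i"
    using b by (simp add: i_def)
  ultimately show ?thesis
    using that b by blast
qed

lemma real_or_complex_cases:
  "(\<forall>x::'f::real_or_complex. x \<in> \<real>) \<or>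
   (\<exists>i::'f. i * i = -1 \<and> conjg i = - i \<and> (\<forall>x. \<exists>a b. x = of_real a + of_real b * i))"
proof (rule disjCI)
  assume "\<not> (\<exists>i::'f. i * i = -1 \<and> conjg i = - i \<and> (\<forall>x. \<exists>a b. x = of_real a + of_real b * i))"
  then have none: "\<And>i::'f. i * i = -1 \<Longrightarrow> conjg i = - i \<Longrightarrow> \<exists>x. \<forall>a b. x \<noteq> of_real a + of_real b * i"
    by blast
  show "\<forall>x::'f. x \<in> \<real>"
  proof (rule ccontr)
    assume "\<not> ?thesis"
    then obtain z :: 'f where "z \<notin> \<real>" by blast
    then obtain i :: 'f where i: "i * i = -1"
      by (metis real_or_complex_quadratic)
    have "(norm i)\<^sup>2 = 1"
      using arg_cong[OF i, of norm] by (simp add: norm_mult power2_eq_square)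
    then have "i * conjg i = i * (- i)"
      using mult_conjg[of i] i by simp
    moreover have "i \<noteq> 0"
      using i by auto
    ultimately have "conjg i = - i"
      using mult_left_cancel by blast
    then obtain x where x: "\<And>a b. x \<noteq> of_real a + of_real b * i"
      using none i by blast
    have "x \<notin> \<real>"
    proof
      assume "x \<in> \<real>"
      then obtain a where "x = of_real a + of_real 0 * i"
        by (auto elim: Reals_cases)
      then show False using x by blast
    qed
    then obtain a b j where j: "x = of_real a + of_real b * j" "j * j = -1"
      by (metis real_or_complex_quadratic)
    then have "j = i \<or> j = - i"
      using i by (metis square_eq_iff)
    then have "x = of_real a + of_real b * i \<or> x = of_real a + of_real (- b) * i"
      using j by auto
    then show False
      using x by blast
  qed
qed

text \<open>
  A Hilbert space over \<open>'f\<close> is carried by a whole Banach type \<open>'a\<close>: the norm, hence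
  completeness, boundedness and closedness, are those of the type, and the axioms tie scalar
  multiplication and inner product to them. The inner product is linear in its first argument.
\<close>

record ('f, 'a) hilbert =
  hscale :: "'f \<Rightarrow> 'a \<Rightarrow> 'a"
  hinner :: "'a \<Rightarrow> 'a \<Rightarrow> 'f"

locale hilbert_space = vector_space "hscale H"
  for H :: "('f::real_or_complex, 'a::banach) hilbert" +
  assumes hscale_of_real: "hscale H (of_real r) x = r *\<^sub>R x"
    and hinner_add_left: "hinner H (x + y) z = hinner H x z + hinner H y z"
    and hinner_hscale_left: "hinner H (hscale H c x) y = c * hinner H x y"
    and hinner_commute: "hinner H y x = conjg (hinner H x y)"
    and hinner_self: "hinner H x x = of_real ((norm x)\<^sup>2)"

lemma hilbert_space_real:
  "hilbert_space \<lparr>hscale = scaleR, hinner = (inner :: 'a::{real_inner, banach} \<Rightarrow> 'a \<Rightarrow> real)\<rparr>"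
  by unfold_locales
    (simp_all add: conjg_real_def inner_commute algebra_simps power2_norm_eq_inner)

lemma hilbert_space_complex:
  "hilbert_space \<lparr>hscale = (*), hinner = (\<lambda>x y. x * cnj y)\<rparr>"
  by unfold_locales
    (simp_all add: conjg_complex_def scaleR_conv_of_real algebra_simps
      complex_norm_square[symmetric] del: of_real_power)

definition bounded_ops ::
    "('f::real_or_complex, 'a::banach) hilbert \<Rightarrow> ('f, 'b::banach) hilbert \<Rightarrow> ('a \<Rightarrow> 'b) set"
  where "bounded_ops H1 H2 =
    {A. Vector_Spaces.linear (hscale H1) (hscale H2) A \<and> bounded_linear A}"

definition closed_range_ops ::
    "('f::real_or_complex, 'a::banach) hilbert \<Rightarrow> ('f, 'b::banach) hilbert \<Rightarrow> ('a \<Rightarrow> 'b) set"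
  where "closed_range_ops H1 H2 = {A \<in> bounded_ops H1 H2. closed (range A)}"

definition null_space :: "('a \<Rightarrow> 'b::zero) \<Rightarrow> 'a set"
  where "null_space A = {x. A x = 0}"

definition hadjoint ::
    "('f::real_or_complex, 'a::banach) hilbert \<Rightarrow> ('f, 'b::banach) hilbert \<Rightarrow> ('a \<Rightarrow> 'b) \<Rightarrow> 'b \<Rightarrow> 'a"
  where "hadjoint H1 H2 A =
    (THE B. B \<in> bounded_ops H2 H1 \<and> (\<forall>x y. hinner H2 (A x) y = hinner H1 x (B y)))"

definition is_134_inverse ::
    "('f::real_or_complex, 'a::banach) hilbert \<Rightarrow> ('f, 'b::banach) hilbert \<Rightarrow>
     ('a \<Rightarrow> 'b) \<Rightarrow> ('b \<Rightarrow> 'a) \<Rightarrow> bool"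
  where "is_134_inverse H1 H2 A X \<longleftrightarrow>
    X \<in> bounded_ops H2 H1 \<and>
    A \<circ> X \<circ> A = A \<and>
    hadjoint H2 H2 (A \<circ> X) = A \<circ> X \<and>
    hadjoint H1 H1 (X \<circ> A) = X \<circ> A"

definition is_MP_inverse ::
    "('f::real_or_complex, 'a::banach) hilbert \<Rightarrow> ('f, 'b::banach) hilbert \<Rightarrow>
     ('a \<Rightarrow> 'b) \<Rightarrow> ('b \<Rightarrow> 'a) \<Rightarrow> bool"
  where "is_MP_inverse H1 H2 A X \<longleftrightarrow>
    X \<in> closed_range_ops H2 H1 \<and>
    A \<circ> X \<circ> A = A \<and>
    X \<circ> A \<circ> X = X \<and>
    hadjoint H2 H2 (A \<circ> X) = A \<circ> X \<and>
    hadjoint H1 H1 (X \<circ> A) = X \<circ> A"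

text \<open>Meaningful only where \<open>is_MP_inverse\<close> has a unique solution.\<close>

definition MP_inverse ::
    "('f::real_or_complex, 'a::banach) hilbert \<Rightarrow> ('f, 'b::banach) hilbert \<Rightarrow> ('a \<Rightarrow> 'b) \<Rightarrow> 'b \<Rightarrow> 'a"
  where "MP_inverse H1 H2 A = (THE X. is_MP_inverse H1 H2 A X)"

end

theory Submission
  imports Defs
begin

text \<open>
  Each \<open>A\<^sub>k\<close> has a Moore--Penrose inverse \<open>X\<^sub>k\<close>. The range of \<open>X\<^sub>k\<close> lies in that of
  \<open>A\<^sub>k\<^sup>*\<close> and the null space of \<open>X\<^sub>k\<close> contains that of \<open>A\<^sub>k\<^sup>*\<close>, so the orthogonality
  hypotheses make all cross products \<open>A\<^sub>j X\<^sub>k\<close> and \<open>X\<^sub>j A\<^sub>k\<close> with \<open>j \<noteq> k\<close> vanish. Hence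
  \<open>X = \<Sum> X\<^sub>k\<close> is the Moore--Penrose inverse of \<open>\<Sum> A\<^sub>k\<close>, and \<open>A\<^sub>k X = A\<^sub>k X\<^sub>k\<close> and
  \<open>X A\<^sub>k = X\<^sub>k A\<^sub>k\<close>.

  For the existence of \<open>X\<^sub>k\<close>, boundedness is the only analytic point. The elements \<open>z\<close> of the closed
  range of \<open>A\<close> with \<open>\<parallel>A\<^sup>* z\<parallel> \<le> 1\<close> are weakly bounded, so the uniform boundedness
  principle gives \<open>\<parallel>z\<parallel> \<le> C \<parallel>A\<^sup>* z\<parallel>\<close> there, and duality turns this into
  \<open>\<parallel>x\<parallel> \<le> C \<parallel>A x\<parallel>\<close> on the orthogonal complement of the null space of \<open>A\<close>.
\<close>

subsection \<open>Inner products\<close>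

lemma conjg_0 [simp]: "conjg (0::'f::real_or_complex) = 0"
  using conjg_add[of "0::'f" 0] by simp

text \<open>The class fixes only additivity and the value of \<open>x * conjg x\<close>. The other
  laws of conjugation come from cancelling a nonzero factor in that identity, here after taking
  norms.\<close>

lemma norm_conjg [simp]: "norm (conjg x) = norm x" for x :: "'f::real_or_complex"
proof (cases "x = 0")
  case False
  have "norm x * norm (conjg x) = norm x * norm x"
    using arg_cong[OF mult_conjg[of x], of norm] by (simp add: norm_mult power2_eq_square)
  with False show ?thesis by simp
qed simp

lemma conjg_conjg [simp]: "conjg (conjg x) = x" for x :: "'f::real_or_complex"
proof (cases "x = 0")
  case False
  then have "conjg x \<noteq> 0"
    by (metis norm_conjg norm_eq_zero)
  moreover have "conjg x * conjg (conjg x) = conjg x * x"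
    by (simp add: mult_conjg mult.commute[of "conjg x" x])
  ultimately show ?thesis by simp
qed simp

lemma conjg_mult: "conjg (x * y) = conjg x * conjg y" for x y :: "'f::real_or_complex"
proof (cases "x * y = 0")
  case False
  have "(x * y) * conjg (x * y) = (x * conjg x) * (y * conjg y)"
    by (simp only: mult_conjg norm_mult power_mult_distrib of_real_mult)
  then have "(x * y) * conjg (x * y) = (x * y) * (conjg x * conjg y)"
    by (simp add: mult_ac)
  with False show ?thesis
    using mult_left_cancel by blast
qed auto

context hilbert_space
begin

lemma hinner_0_left [simp]: "hinner H 0 y = 0"
  using hinner_add_left[of 0 0 y] by simp

lemma hinner_minus_left: "hinner H (- x) y = - hinner H x y"
  using hinner_add_left[of x "- x" y] by (simp add: eq_neg_iff_add_eq_0 add.commute)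

lemma hinner_diff_left: "hinner H (x - y) z = hinner H x z - hinner H y z"
  using hinner_add_left[of x "- y" z] by (simp add: hinner_minus_left)

lemma hinner_scaleR_left: "hinner H (r *\<^sub>R x) y = of_real r * hinner H x y"
  by (simp add: hscale_of_real[symmetric] hinner_hscale_left)

lemma hinner_add_right: "hinner H x (y + z) = hinner H x y + hinner H x z"
  by (metis hinner_commute hinner_add_left conjg_add)

lemma hinner_0_right [simp]: "hinner H x 0 = 0"
  using hinner_add_right[of x 0 0] by simp

lemma hinner_minus_right: "hinner H x (- y) = - hinner H x y"
  using hinner_add_right[of x y "- y"] by (simp add: eq_neg_iff_add_eq_0 add.commute)

lemma hinner_diff_right: "hinner H x (y - z) = hinner H x y - hinner H x z"
  using hinner_add_right[of x y "- z"] by (simp add: hinner_minus_right)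

lemma hinner_hscale_right: "hinner H x (hscale H c y) = conjg c * hinner H x y"
  by (metis hinner_commute hinner_hscale_left conjg_mult)

lemma hinner_eq_0_commute: "hinner H x y = 0 \<longleftrightarrow> hinner H y x = 0"
  by (metis hinner_commute conjg_0)

lemma hinner_self_eq_0: "hinner H x x = 0 \<longleftrightarrow> x = 0"
  by (simp add: hinner_self)

text \<open>The axioms relate scaling to the norm directly only for real scalars; for a general
  \<open>c\<close> the relation passes through the inner product, using
  \<open>c * conjg c\<close>.\<close>

lemma norm_hscale: "norm (hscale H c x) = norm c * norm x"
proof -
  have "hinner H (hscale H c x) (hscale H c x) = (c * conjg c) * hinner H x x"
    by (simp add: hinner_hscale_left hinner_hscale_right mult_ac)
  then have "(norm (hscale H c x))\<^sup>2 = (norm c * norm x)\<^sup>2"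
    by (simp only: hinner_self mult_conjg power_mult_distrib of_real_eq_iff flip: of_real_mult)
  then show ?thesis
    by (simp add: power2_eq_iff_nonneg)
qed

lemma pythagoras:
  assumes "hinner H x y = 0"
  shows "(norm (x + y))\<^sup>2 = (norm x)\<^sup>2 + (norm y)\<^sup>2"
proof -
  have "hinner H (x + y) (x + y) = hinner H x x + hinner H y y"
    using assms hinner_eq_0_commute by (simp add: hinner_add_left hinner_add_right)
  then show ?thesis
    by (simp only: hinner_self of_real_eq_iff flip: of_real_add)
qed

lemma parallelogram:
  fixes x y :: 'a
  shows "(norm (x + y))\<^sup>2 + (norm (x - y))\<^sup>2 = 2 * (norm x)\<^sup>2 + 2 * (norm y)\<^sup>2"
proof -
  have "hinner H (x + y) (x + y) + hinner H (x - y) (x - y)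
      = hinner H x x + hinner H x x + (hinner H y y + hinner H y y)"
    by (simp add: hinner_add_left hinner_add_right hinner_diff_left hinner_diff_right)
  then have "(norm (x + y))\<^sup>2 + (norm (x - y))\<^sup>2
      = (norm x)\<^sup>2 + (norm x)\<^sup>2 + ((norm y)\<^sup>2 + (norm y)\<^sup>2)"
    by (simp only: hinner_self of_real_eq_iff flip: of_real_add)
  then show ?thesis by simp
qed

text \<open>One Gram-Schmidt step. It yields both the Cauchy-Schwarz inequality and the
  orthogonality property of nearest points.\<close>

lemma orthogonal_component:
  fixes x y :: 'a
  assumes "y \<noteq> 0"
  defines "c \<equiv> hinner H x y / of_real ((norm y)\<^sup>2)"
  shows "hinner H (x - hscale H c y) y = 0"
    and "(norm x)\<^sup>2 = (norm (x - hscale H c y))\<^sup>2 + (norm (hscale H c y))\<^sup>2"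
proof -
  show o: "hinner H (x - hscale H c y) y = 0"
    using assms by (simp add: hinner_diff_left hinner_hscale_left hinner_self)
  show "(norm x)\<^sup>2 = (norm (x - hscale H c y))\<^sup>2 + (norm (hscale H c y))\<^sup>2"
    using pythagoras[of "x - hscale H c y" "hscale H c y"] o
    by (simp add: hinner_hscale_right)
qed

text \<open>The component of \<open>x\<close> along \<open>y\<close> is no longer than
  \<open>x\<close>.\<close>

lemma Cauchy_Schwarz: "norm (hinner H x y) \<le> norm x * norm y"
proof (cases "y = 0")
  case False
  define c where "c = hinner H x y / of_real ((norm y)\<^sup>2)"
  have "(norm (hscale H c y))\<^sup>2 \<le> (norm x)\<^sup>2"
    using orthogonal_component(2)[OF False, of x] by (simp add: c_def)
  then have "norm (hscale H c y) \<le> norm x"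
    by (simp add: power2_le_iff_abs_le)
  then have "norm c * norm y \<le> norm x"
    by (simp add: norm_hscale)
  moreover have "norm c * norm y = norm (hinner H x y) / norm y"
    using False by (simp add: c_def norm_divide norm_mult power2_eq_square)
  ultimately show ?thesis
    using False by (simp add: pos_divide_le_eq)
qed simp

lemma bounded_linear_hinner_left: "bounded_linear (\<lambda>x. hinner H x y)"
  by (rule bounded_linear_intro[where K = "norm y"])
    (simp_all add: hinner_add_left hinner_scaleR_left scaleR_conv_of_real Cauchy_Schwarz)

lemma hinner_sum_left: "hinner H (\<Sum>i\<in>I. f i) y = (\<Sum>i\<in>I. hinner H (f i) y)"
  by (induction I rule: infinite_finite_induct) (simp_all add: hinner_add_left)

lemma hinner_sum_right: "hinner H x (\<Sum>i\<in>I. f i) = (\<Sum>i\<in>I. hinner H x (f i))"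
  by (induction I rule: infinite_finite_induct) (simp_all add: hinner_add_right)

lemma conjg_of_real: "conjg (of_real r :: 'f) = of_real r"
proof (cases "r = 0")
  case False
  have "of_real r * conjg (of_real r :: 'f) = of_real r * of_real r"
    by (simp add: mult_conjg power2_eq_square)
  with False show ?thesis by simp
qed simp

lemma bounded_linear_hinner_right: "bounded_linear (\<lambda>y. hinner H x y)"
proof (rule bounded_linear_intro[where K = "norm x"])
  show "hinner H x (r *\<^sub>R y) = r *\<^sub>R hinner H x y" for r y
    by (simp add: hscale_of_real[symmetric] hinner_hscale_right conjg_of_real scaleR_conv_of_real)
  show "norm (hinner H x y) \<le> norm y * norm x" for y
    using Cauchy_Schwarz[of x y] by (simp add: mult.commute)
qed (simp add: hinner_add_right)

subsection \<open>Projections, Riesz representation and uniform boundedness\<close>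

lemma subspace_scaleR:
  assumes "subspace M" "x \<in> M"
  shows "r *\<^sub>R x \<in> M"
  using subspace_scale[OF assms, of "of_real r"] by (simp add: hscale_of_real)

text \<open>A minimising sequence is Cauchy by the parallelogram law, and its limit stays in the
  closed set \<open>M\<close>. Distances are controlled through their squares, since these are what
  the law relates.\<close>

lemma exists_nearest:
  assumes "subspace M" "closed M"
  obtains m where "m \<in> M" "\<And>y. y \<in> M \<Longrightarrow> norm (x - m) \<le> norm (x - y)"
proof -
  define d where "d = infdist x M"
  have ne: "M \<noteq> {}"
    using subspace_0[OF assms(1)] by blast
  have d_le: "d \<le> norm (x - y)" if "y \<in> M" for y
    using infdist_le[OF that, of x] by (simp add: d_def dist_norm)
  have d0: "0 \<le> d"
    by (simp add: d_def infdist_nonneg)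
  have "\<exists>y\<in>M. (norm (x - y))\<^sup>2 < d\<^sup>2 + 1 / real (Suc n)" for n
  proof (rule ccontr)
    assume "\<not> ?thesis"
    then have "sqrt (d\<^sup>2 + 1 / real (Suc n)) \<le> dist x y" if "y \<in> M" for y
      using that by (intro real_le_lsqrt) (auto simp: dist_norm not_less)
    then have "sqrt (d\<^sup>2 + 1 / real (Suc n)) \<le> d"
      unfolding d_def infdist_def using ne by (auto intro: cINF_greatest)
    then have "d\<^sup>2 + 1 / real (Suc n) \<le> d\<^sup>2"
      using d0 by (simp add: real_sqrt_le_iff' sqrt_le_D)
    then show False by simp
  qed
  then obtain s where s: "\<And>n. s n \<in> M" "\<And>n. (norm (x - s n))\<^sup>2 < d\<^sup>2 + 1 / real (Suc n)"
    by metis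
  have close: "(norm (s i - s j))\<^sup>2 \<le> 2 / real (Suc i) + 2 / real (Suc j)" for i j
  proof -
    \<comment> \<open>The midpoint belongs to \<open>M\<close>, so it is at distance at least
      \<open>d\<close> from \<open>x\<close>. In the parallelogram law the terms in \<open>d\<close>
      then cancel and only the two errors remain.\<close>
    have "(1/2) *\<^sub>R (s i + s j) \<in> M"
      using s(1) assms(1) by (intro subspace_scaleR subspace_add)
    then have "d \<le> norm (x - (1/2) *\<^sub>R (s i + s j))"
      by (rule d_le)
    also have "2 * \<dots> = norm (2 *\<^sub>R (x - (1/2) *\<^sub>R (s i + s j)))"
      by simp
    also have "2 *\<^sub>R (x - (1/2) *\<^sub>R (s i + s j)) = (x - s i) + (x - s j)"
      by (simp add: algebra_simps scaleR_2)
    finally have "2 * d \<le> norm ((x - s i) + (x - s j))"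
      by simp
    then have "4 * d\<^sup>2 \<le> (norm ((x - s i) + (x - s j)))\<^sup>2"
      using power_mono[of "2 * d" _ 2] d0 by (simp add: power_mult_distrib)
    moreover have "norm ((x - s i) - (x - s j)) = norm (s i - s j)"
      by (simp add: norm_minus_commute)
    ultimately show ?thesis
      using parallelogram[of "x - s i" "x - s j"] s(2)[of i] s(2)[of j] by simp
  qed
  have "Cauchy s"
  proof (rule metric_CauchyI)
    fix e :: real
    assume e: "0 < e"
    then obtain n :: nat where n: "4 / e\<^sup>2 < real n"
      using reals_Archimedean2 by blast
    have "dist (s i) (s j) < e" if "n \<le> i" "n \<le> j" for i j
    proof -
      have "0 < 4 / e\<^sup>2"
        using e by simp
      with n have "0 < real n"
        by (rule less_trans[rotated])
      then have npos: "0 < real n" "0 < e\<^sup>2"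
        using e by auto
      have "(norm (s i - s j))\<^sup>2 \<le> 2 / real (Suc i) + 2 / real (Suc j)"
        by (rule close)
      also have "\<dots> \<le> 2 / real n + 2 / real n"
        using that npos by (intro add_mono divide_left_mono) auto
      also have "\<dots> < e\<^sup>2"
      proof -
        have "4 < real n * e\<^sup>2"
          using n npos(2) by (simp only: pos_divide_less_eq)
        then have "4 / real n < e\<^sup>2"
          using npos(1) by (simp only: pos_divide_less_eq mult.commute[of "e\<^sup>2"])
        then show ?thesis by simp
      qed
      finally show ?thesis
        unfolding dist_norm using e by (auto intro: power2_less_imp_less)
    qed
    then show "\<exists>n. \<forall>i\<ge>n. \<forall>j\<ge>n. dist (s i) (s j) < e"
      by blast
  qed
  then obtain m where m: "s \<longlonglongrightarrow> m"
    using Cauchy_convergent convergent_def by blast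
  have "m \<in> M"
    by (rule closed_sequentially[OF assms(2) s(1) m])
  moreover have "(\<lambda>n. (norm (x - s n))\<^sup>2) \<longlonglongrightarrow> (norm (x - m))\<^sup>2"
    by (intro tendsto_intros m)
  moreover have "(\<lambda>n. d\<^sup>2 + 1 / real (Suc n)) \<longlonglongrightarrow> d\<^sup>2 + 0"
    by (intro tendsto_intros LIMSEQ_Suc[OF lim_1_over_n])
  ultimately have "(norm (x - m))\<^sup>2 \<le> d\<^sup>2 + 0"
    using less_imp_le[OF s(2)] by (blast intro: LIMSEQ_le)
  then have "norm (x - m) \<le> d"
    using d0 by (auto intro: power2_le_imp_le)
  then have "norm (x - m) \<le> norm (x - y)" if "y \<in> M" for y
    using d_le[OF that] by (rule order_trans)
  with \<open>m \<in> M\<close> show ?thesis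
    by (rule that)
qed

text \<open>The nearest point works: if \<open>x - m\<close> had a nonzero component along some
  \<open>y\<close> in \<open>M\<close>, adding that component to \<open>m\<close> would bring it
  closer to \<open>x\<close>.\<close>

lemma projection:
  assumes "subspace M" "closed M"
  obtains m where "m \<in> M" "\<And>y. y \<in> M \<Longrightarrow> hinner H (x - m) y = 0"
proof -
  obtain m where m: "m \<in> M" "\<And>y. y \<in> M \<Longrightarrow> norm (x - m) \<le> norm (x - y)"
    using exists_nearest[OF assms] by blast
  have "hinner H (x - m) y = 0" if y: "y \<in> M" for y
  proof (cases "y = 0")
    case False
    define c where "c = hinner H (x - m) y / of_real ((norm y)\<^sup>2)"
    have "m + hscale H c y \<in> M"
      using assms(1) m(1) y by (intro subspace_add subspace_scale)
    then have "norm (x - m) \<le> norm (x - m - hscale H c y)"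
      using m(2) by (simp add: diff_diff_eq)
    then have "(norm (x - m))\<^sup>2 \<le> (norm (x - m - hscale H c y))\<^sup>2"
      by simp
    then have "hscale H c y = 0"
      using orthogonal_component(2)[OF False, of "x - m"] by (simp add: c_def)
    then show ?thesis
      using False by (simp add: c_def)
  qed simp
  with m(1) that show ?thesis by blast
qed

text \<open>A nonzero functional is determined by its closed kernel \<open>N\<close> and its value
  at one vector \<open>u\<close> orthogonal to \<open>N\<close>, because
  \<open>x - hscale H (f x / f u) u\<close> always lies in \<open>N\<close>.\<close>

lemma riesz:
  assumes f: "bounded_linear f" and scale: "\<And>c x. f (hscale H c x) = c * f x"
  obtains z where "\<And>x. f x = hinner H x z"
proof (cases "\<forall>x. f x = 0")
  case True
  then show ?thesis
    using that[of 0] by simp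
next
  case False
  then obtain x0 where x0: "f x0 \<noteq> 0" by blast
  interpret f: bounded_linear f by (fact f)
  define N where "N = {x. f x = 0}"
  have "closed N"
    unfolding N_def by (intro closed_Collect_eq continuous_intros f.continuous_on)
  moreover have "subspace N"
    by (auto simp: subspace_def N_def f.zero f.add scale)
  ultimately obtain m where m: "m \<in> N" "\<And>y. y \<in> N \<Longrightarrow> hinner H (x0 - m) y = 0"
    using projection by blast
  define u where "u = x0 - m"
  have fu: "f u \<noteq> 0"
    using m(1) x0 by (simp add: u_def N_def f.diff)
  then have u: "u \<noteq> 0"
    using f.zero by auto
  \<comment> \<open>The inner product is conjugate linear in its second argument, so the factor is
    conjugated in advance.\<close>
  have "f x = hinner H x (hscale H (conjg (f u / of_real ((norm u)\<^sup>2))) u)" for x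
  proof -
    have "x - hscale H (f x / f u) u \<in> N"
      using fu by (simp add: N_def f.diff scale)
    then have "hinner H (x - hscale H (f x / f u) u) u = 0"
      using m(2) u_def hinner_eq_0_commute by blast
    then have "hinner H x u = f x / f u * of_real ((norm u)\<^sup>2)"
      by (simp add: hinner_diff_left hinner_hscale_left hinner_self)
    then show ?thesis
      using fu u by (simp add: hinner_hscale_right)
  qed
  then show ?thesis by (rule that)
qed

text \<open>Baire category: the closed sets \<open>F n\<close> cover the space, so one of them
  contains a ball, and a bound on a ball bounds the norms of all \<open>z\<close> in
  \<open>S\<close>.\<close>

lemma uniform_boundedness:
  assumes "\<And>y. \<exists>B. \<forall>z\<in>S. norm (hinner H y z) \<le> B"
  obtains C where "\<And>z. z \<in> S \<Longrightarrow> norm z \<le> C"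
proof -
  define F where "F n = {y. \<forall>z\<in>S. norm (hinner H y z) \<le> real n}" for n :: nat
  have closed: "closed (F n)" for n
  proof -
    have "closed {y. norm (hinner H y z) \<le> real n}" for z
      by (intro closed_Collect_le continuous_intros
          bounded_linear.continuous_on[OF bounded_linear_hinner_left])
    moreover have "F n = (\<Inter>z\<in>S. {y. norm (hinner H y z) \<le> real n})"
      by (auto simp: F_def)
    ultimately show ?thesis
      by (simp add: closed_INT)
  qed
  have "(\<Union>n. F n) = UNIV"
  proof -
    have "y \<in> (\<Union>n. F n)" for y
    proof -
      obtain B where "\<forall>z\<in>S. norm (hinner H y z) \<le> B"
        using assms by blast
      moreover obtain n :: nat where "B \<le> real n"
        using real_arch_simple by blast
      ultimately have "y \<in> F n"
        unfolding F_def by (auto intro: order_trans)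
      then show ?thesis by blast
    qed
    then show ?thesis by blast
  qed
  have "\<exists>n. interior (F n) \<noteq> {}"
  proof (rule ccontr)
    assume "\<not> ?thesis"
    then have "interior (\<Union>n. F n) = {}"
      using Met_TC.metric_Baire_category_alt[where \<G> = "range F" and 'a = 'a] closed
      by (simp add: image_iff) (metis complete_UNIV)
    then show False
      using \<open>(\<Union>n. F n) = UNIV\<close> by simp
  qed
  then obtain n y0 where "y0 \<in> interior (F n)" by blast
  then obtain r where r: "r > 0" "cball y0 r \<subseteq> F n"
    by (meson mem_interior_cball)
  have "norm z \<le> 2 * real n / r" if z: "z \<in> S" for z
  proof (cases "z = 0")
    case False
    \<comment> \<open>Rescaling \<open>z\<close> to length \<open>r\<close> keeps
      \<open>y0 + y\<close> in the ball, while the pairing of \<open>y\<close> with \<open>z\<close>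
      has norm \<open>r * norm z\<close>.\<close>
    define y where "y = (r / norm z) *\<^sub>R z"
    have "y0 + y \<in> cball y0 r" "y0 \<in> cball y0 r"
      using r False by (auto simp: y_def dist_norm)
    then have "y0 + y \<in> F n" "y0 \<in> F n"
      using r(2) by (blast dest: subsetD)+
    then have "norm (hinner H (y0 + y) z) \<le> real n" "norm (hinner H y0 z) \<le> real n"
      using z by (simp_all add: F_def)
    moreover have "norm (hinner H y z) \<le> norm (hinner H (y0 + y) z) + norm (hinner H y0 z)"
      using norm_triangle_ineq4[of "hinner H (y0 + y) z" "hinner H y0 z"]
      by (simp add: hinner_add_left)
    moreover have "norm (hinner H y z) = r * norm z"
      using False r(1)
      by (simp add: y_def hinner_scaleR_left hinner_self norm_mult norm_divide power2_eq_square)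
    ultimately show ?thesis
      using r(1) by (simp add: field_simps)
  qed (use r in simp)
  then show ?thesis by (rule that)
qed

lemma bounded_linear_hscale: "bounded_linear (hscale H c)"
proof (rule bounded_linear_intro[where K = "norm c"])
  show "hscale H c (r *\<^sub>R x) = r *\<^sub>R hscale H c x" for r x
    by (simp add: hscale_of_real[symmetric] mult.commute)
qed (simp_all add: norm_hscale scale_right_distrib mult.commute)

lemma subspace_closure:
  assumes "subspace M"
  shows "subspace (closure M)"
proof (rule subspaceI)
  show "0 \<in> closure M"
    using subspace_0[OF assms] closure_subset by blast
next
  fix x y assume "x \<in> closure M" "y \<in> closure M"
  then obtain f g where "\<And>n. f n \<in> M" "f \<longlonglongrightarrow> x" "\<And>n. g n \<in> M" "g \<longlonglongrightarrow> y"
    by (auto simp: closure_sequential)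
  then have "(\<lambda>n. f n + g n) \<longlonglongrightarrow> x + y" "\<And>n. f n + g n \<in> M"
    using assms by (auto intro: tendsto_add subspace_add)
  then show "x + y \<in> closure M"
    unfolding closure_sequential by (intro exI[where x = "\<lambda>n. f n + g n"]) auto
next
  fix c x assume "x \<in> closure M"
  then obtain f where "\<And>n. f n \<in> M" "f \<longlonglongrightarrow> x"
    by (auto simp: closure_sequential)
  then have "(\<lambda>n. hscale H c (f n)) \<longlonglongrightarrow> hscale H c x" "\<And>n. hscale H c (f n) \<in> M"
    using assms
    by (auto intro: bounded_linear.tendsto[OF bounded_linear_hscale] subspace_scale)
  then show "hscale H c x \<in> closure M"
    unfolding closure_sequential by (intro exI[where x = "\<lambda>n. hscale H c (f n)"]) auto
qed

lemma hinner_left_eqI: "(\<And>y. hinner H x y = hinner H x' y) \<Longrightarrow> x = x'"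
  using hinner_self_eq_0[of "x - x'"] by (simp add: hinner_diff_left)

lemma hinner_right_eqI: "(\<And>y. hinner H y x = hinner H y x') \<Longrightarrow> x = x'"
  using hinner_self_eq_0[of "x - x'"] by (simp add: hinner_diff_right)

end

subsection \<open>Bounded operators and adjoints\<close>

locale hilbert_space_pair = H1: hilbert_space H1 + H2: hilbert_space H2
  for H1 :: "('f::real_or_complex, 'a::banach) hilbert"
    and H2 :: "('f, 'b::banach) hilbert"
begin

lemma bounded_ops_iff:
  "T \<in> bounded_ops H1 H2 \<longleftrightarrow>
    bounded_linear T \<and> (\<forall>c x. T (hscale H1 c x) = hscale H2 c (T x))"
proof
  assume "T \<in> bounded_ops H1 H2"
  then show "bounded_linear T \<and> (\<forall>c x. T (hscale H1 c x) = hscale H2 c (T x))"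
    by (auto simp: bounded_ops_def linear_iff_module_hom module_hom.scale)
next
  assume T: "bounded_linear T \<and> (\<forall>c x. T (hscale H1 c x) = hscale H2 c (T x))"
  then interpret T: bounded_linear T
    by blast
  have "Vector_Spaces.linear (hscale H1) (hscale H2) T"
    by unfold_locales (use T in \<open>simp_all add: T.add\<close>)
  with T show "T \<in> bounded_ops H1 H2"
    by (simp add: bounded_ops_def)
qed

lemmas bounded_opsD =
  bounded_ops_iff[THEN iffD1, THEN conjunct2, rule_format]
  bounded_ops_iff[THEN iffD1, THEN conjunct1]

lemma subspace_range:
  assumes "T \<in> bounded_ops H1 H2" "H1.subspace M"
  shows "H2.subspace (T ` M)"
proof -
  interpret T: bounded_linear T
    by (rule bounded_opsD(2)[OF assms(1)])
  note M = H1.subspace_0[OF assms(2)] H1.subspace_add[OF assms(2)] H1.subspace_scale[OF assms(2)]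
  show ?thesis
  proof (rule H2.subspaceI)
    show "0 \<in> T ` M"
      using M(1) T.zero by (metis imageI)
  qed (auto simp flip: T.add bounded_opsD(1)[OF assms(1)] intro!: imageI M)
qed

text \<open>By linearity the bound also makes the graph single-valued.\<close>

lemma bounded_op_from_graph:
  assumes total: "\<And>x. \<exists>y. G x y"
    and add: "\<And>x y x' y'. G x y \<Longrightarrow> G x' y' \<Longrightarrow> G (x + x') (y + y')"
    and scale: "\<And>c x y. G x y \<Longrightarrow> G (hscale H1 c x) (hscale H2 c y)"
    and bound: "\<And>x y. G x y \<Longrightarrow> norm y \<le> norm x * C"
  obtains T where "T \<in> bounded_ops H1 H2" "\<And>x. G x (T x)"
proof -
  obtain T where T: "\<And>x. G x (T x)"
    using total by metis
  have unique: "y = T x" if "G x y" for x y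
  proof -
    have "G (x + hscale H1 (- 1) x) (y + hscale H2 (- 1) (T x))"
      by (intro add scale T that)
    then show ?thesis
      using bound by fastforce
  qed
  have scale_T: "T (hscale H1 c x) = hscale H2 c (T x)" for c x
    by (intro unique[symmetric] scale T)
  have "bounded_linear T"
  proof (rule bounded_linear_intro[where K = C])
    show "T (x + y) = T x + T y" for x y
      by (intro unique[symmetric] add T)
    show "T (r *\<^sub>R x) = r *\<^sub>R T x" for r x
      using scale_T[of "of_real r" x] by (simp add: H1.hscale_of_real H2.hscale_of_real)
  qed (intro bound T)
  with scale_T have "T \<in> bounded_ops H1 H2"
    by (simp add: bounded_ops_iff)
  then show ?thesis
    using T that by blast
qed

text \<open>Riesz representation of \<open>hinner H2 (A x) y\<close> as a functional of
  \<open>x\<close> gives the value at \<open>y\<close>. Testing the defining identity at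
  \<open>x = z\<close> bounds it by the constant of \<open>A\<close>.\<close>

lemma adjoint_exists:
  assumes "A \<in> bounded_ops H1 H2"
  obtains B where "B \<in> bounded_ops H2 H1" "\<And>x y. hinner H2 (A x) y = hinner H1 x (B y)"
proof -
  interpret rev: hilbert_space_pair H2 H1 ..
  interpret A: bounded_linear A
    by (rule bounded_opsD(2)[OF assms])
  obtain C where C: "\<And>x. norm (A x) \<le> norm x * C"
    and "0 \<le> C"
    using A.nonneg_bounded by blast
  define G where "G y z \<longleftrightarrow> (\<forall>x. hinner H2 (A x) y = hinner H1 x z)" for y z
  obtain B where "B \<in> bounded_ops H2 H1" "\<And>y. G y (B y)"
  proof (rule rev.bounded_op_from_graph[of G C])
    fix y
    have "bounded_linear (\<lambda>x. hinner H2 (A x) y)"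
      by (rule bounded_linear_compose[OF H2.bounded_linear_hinner_left A.bounded_linear])
    then obtain z where "\<And>x. hinner H2 (A x) y = hinner H1 x z"
      by (rule H1.riesz) (auto simp: bounded_opsD(1)[OF assms] H2.hinner_hscale_left)
    then show "\<exists>z. G y z"
      by (auto simp: G_def)
  next
    fix y z assume G: "G y z"
    show "norm z \<le> norm y * C"
    proof (cases "z = 0")
      case False
      have "(norm z)\<^sup>2 = norm (hinner H2 (A z) y)"
        using G by (simp add: G_def H1.hinner_self norm_power)
      also have "\<dots> \<le> norm (A z) * norm y"
        by (rule H2.Cauchy_Schwarz)
      also have "\<dots> \<le> norm z * C * norm y"
        by (intro mult_right_mono C) simp
      finally show ?thesis
        using False by (simp add: power2_eq_square mult.commute)
    qed (use \<open>0 \<le> C\<close> in simp)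
  qed (auto simp: G_def H1.hinner_add_right H2.hinner_add_right
      H1.hinner_hscale_right H2.hinner_hscale_right)
  then show ?thesis
    using that by (auto simp: G_def)
qed

lemma hadjoint_eqI:
  assumes "B \<in> bounded_ops H2 H1" "\<And>x y. hinner H2 (A x) y = hinner H1 x (B y)"
  shows "hadjoint H1 H2 A = B"
  unfolding hadjoint_def
proof (rule the_equality)
  fix B' assume "B' \<in> bounded_ops H2 H1 \<and> (\<forall>x y. hinner H2 (A x) y = hinner H1 x (B' y))"
  then show "B' = B"
    using assms(2) by (intro ext H1.hinner_right_eqI) simp
qed (use assms in blast)

lemma
  assumes "A \<in> bounded_ops H1 H2"
  shows hadjoint_bounded_ops: "hadjoint H1 H2 A \<in> bounded_ops H2 H1"
    and hinner_hadjoint: "hinner H2 (A x) y = hinner H1 x (hadjoint H1 H2 A y)"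
proof -
  obtain B where "B \<in> bounded_ops H2 H1" "\<And>x y. hinner H2 (A x) y = hinner H1 x (B y)"
    using adjoint_exists[OF assms] by blast
  moreover from this have "hadjoint H1 H2 A = B"
    by (rule hadjoint_eqI)
  ultimately show "hadjoint H1 H2 A \<in> bounded_ops H2 H1"
    and "hinner H2 (A x) y = hinner H1 x (hadjoint H1 H2 A y)"
    by auto
qed

section \<open>Lower bounds for closed-range operators and their adjoints\<close>

text \<open>\<open>S\<close> normalises the image under the adjoint instead of \<open>z\<close>, so
  uniform boundedness of \<open>S\<close> is the estimate up to scaling. Vectors that the adjoint
  kills cannot be scaled this way and are treated separately.\<close>

lemma adjoint_bounded_below_on_range:
  assumes "A \<in> closed_range_ops H1 H2"
  obtains C where "0 \<le> C" "\<And>z. z \<in> range A \<Longrightarrow> norm z \<le> C * norm (hadjoint H1 H2 A z)"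
proof -
  have A: "A \<in> bounded_ops H1 H2" and "closed (range A)"
    using assms by (auto simp: closed_range_ops_def)
  note adj = hinner_hadjoint[OF A]
  interpret B: bounded_linear "hadjoint H1 H2 A"
    using hadjoint_bounded_ops[OF A] by (simp add: bounded_ops_def)
  have R: "H2.subspace (range A)"
    by (rule subspace_range[OF A H1.subspace_UNIV])
  define S where "S = {z \<in> range A. norm (hadjoint H1 H2 A z) \<le> 1}"
  have "\<exists>B. \<forall>z\<in>S. norm (hinner H2 y z) \<le> B" for y
  proof -
    \<comment> \<open>\<open>A u\<close> is the projection of \<open>y\<close> onto the closed
      range. Against \<open>z\<close> in the range, \<open>y\<close> may be replaced by
      \<open>A u\<close>, which moves over to the adjoint; the bound \<open>norm u\<close> depends
      on \<open>y\<close> alone.\<close>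
    obtain u where u: "\<And>z. z \<in> range A \<Longrightarrow> hinner H2 (y - A u) z = 0"
      using H2.projection[OF R \<open>closed (range A)\<close>] by (metis rangeE)
    have "norm (hinner H2 y z) \<le> norm u" if "z \<in> S" for z
    proof -
      have "hinner H2 y z = hinner H1 u (hadjoint H1 H2 A z)"
        using u[of z] that by (simp add: S_def H2.hinner_diff_left adj)
      also have "norm \<dots> \<le> norm u * norm (hadjoint H1 H2 A z)"
        by (rule H1.Cauchy_Schwarz)
      also have "\<dots> \<le> norm u * 1"
        using that by (intro mult_left_mono) (auto simp: S_def)
      finally show ?thesis by simp
    qed
    then show ?thesis by blast
  qed
  then obtain C where C: "\<And>z. z \<in> S \<Longrightarrow> norm z \<le> C"
    using H2.uniform_boundedness by blast
  have "0 \<in> S"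
    using H2.subspace_0[OF R] by (simp add: S_def B.zero)
  then have "0 \<le> C"
    using C by fastforce
  moreover have "norm z \<le> C * norm (hadjoint H1 H2 A z)" if z: "z \<in> range A" for z
  proof (cases "hadjoint H1 H2 A z = 0")
    case True
    obtain u where "z = A u" using z by blast
    then have "hinner H2 z z = 0"
      using adj[of u z] True by simp
    then show ?thesis
      using True by (simp add: H2.hinner_self_eq_0)
  next
    case False
    define r where "r = 1 / norm (hadjoint H1 H2 A z)"
    have "r *\<^sub>R z \<in> S"
      using H2.subspace_scaleR[OF R z] False by (simp add: S_def B.scaleR r_def)
    then have "norm (r *\<^sub>R z) \<le> C"
      by (rule C)
    then show ?thesis
      using False by (simp add: r_def pos_divide_le_eq)
  qed
  ultimately show ?thesis by (rule that)
qed

text \<open>A vector orthogonal to the null space lies in \<open>L\<close>, the closure of the image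
  of \<open>range A\<close> under the adjoint. Pairing it with elements of that image transfers the
  lower bound from the adjoint to \<open>A\<close>.\<close>

lemma bounded_below_on_orthogonal_null_space:
  assumes "A \<in> closed_range_ops H1 H2"
  obtains C where "0 \<le> C"
    "\<And>x. (\<And>n. A n = 0 \<Longrightarrow> hinner H1 x n = 0) \<Longrightarrow> norm x \<le> C * norm (A x)"
proof -
  interpret rev: hilbert_space_pair H2 H1 ..
  have A: "A \<in> bounded_ops H1 H2"
    using assms by (simp add: closed_range_ops_def)
  interpret A: bounded_linear A
    by (rule bounded_opsD(2)[OF A])
  define B where "B = hadjoint H1 H2 A"
  have B: "B \<in> bounded_ops H2 H1"
    unfolding B_def by (rule hadjoint_bounded_ops[OF A])
  have adj: "hinner H2 (A x) y = hinner H1 x (B y)" for x y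
    unfolding B_def by (rule hinner_hadjoint[OF A])
  obtain C where C: "0 \<le> C" "\<And>z. z \<in> range A \<Longrightarrow> norm z \<le> C * norm (B z)"
    unfolding B_def using adjoint_bounded_below_on_range[OF assms] by blast
  define L where "L = closure (B ` range A)"
  have L: "H1.subspace L"
    unfolding L_def
    by (intro H1.subspace_closure rev.subspace_range B subspace_range A H1.subspace_UNIV)
  have "norm x \<le> C * norm (A x)" if x: "\<And>n. A n = 0 \<Longrightarrow> hinner H1 x n = 0" for x
  proof -
    have "closed L" by (simp add: L_def)
    then obtain m where m: "m \<in> L" "\<And>y. y \<in> L \<Longrightarrow> hinner H1 (x - m) y = 0"
      using H1.projection[OF L] by blast
    \<comment> \<open>This test vector turns orthogonality to \<open>L\<close> into
      \<open>A (x - m) = 0\<close>. The hypothesis on \<open>x\<close> then makes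
      \<open>x - m\<close> orthogonal to \<open>x\<close> as well as to \<open>m\<close>, hence
      zero.\<close>
    have "B (A (x - m)) \<in> L"
      unfolding L_def by (rule subsetD[OF closure_subset]) simp
    then have "hinner H2 (A (x - m)) (A (x - m)) = 0"
      using m(2) by (simp add: adj)
    then have "A (x - m) = 0"
      by (simp add: H2.hinner_self_eq_0)
    then have "hinner H1 x (x - m) = 0"
      by (rule x)
    moreover have "hinner H1 m (x - m) = 0"
      using m H1.hinner_eq_0_commute by blast
    ultimately have "hinner H1 (x - m) (x - m) = 0"
      by (simp add: H1.hinner_diff_left)
    then have "x \<in> L"
      using m(1) by (simp add: H1.hinner_self_eq_0)
    \<comment> \<open>The estimate is checked on the image itself and extends to \<open>L\<close>
      because \<open>T\<close> is closed; it is finally applied with \<open>u = x\<close>.\<close>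
    define T where "T = {u. norm (hinner H1 x u) \<le> C * norm (A x) * norm u}"
    have "closed T"
      unfolding T_def
      by (intro closed_Collect_le continuous_intros
          bounded_linear.continuous_on[OF H1.bounded_linear_hinner_right])
    moreover have "B ` range A \<subseteq> T"
    proof -
      have "norm (hinner H1 x (B z)) \<le> C * norm (A x) * norm (B z)" if "z \<in> range A" for z
      proof -
        have "norm (hinner H1 x (B z)) \<le> norm (A x) * norm z"
          unfolding adj[symmetric] by (rule H2.Cauchy_Schwarz)
        also have "\<dots> \<le> norm (A x) * (C * norm (B z))"
          by (intro mult_left_mono C that) simp
        finally show ?thesis by (simp add: mult_ac)
      qed
      then show ?thesis by (auto simp: T_def)
    qed
    ultimately have "L \<subseteq> T"
      unfolding L_def by (intro closure_minimal)
    with \<open>x \<in> L\<close> have "x \<in> T" by (rule subsetD[rotated])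
    then have "norm x * norm x \<le> C * norm (A x) * norm x"
      by (simp add: T_def H1.hinner_self power2_eq_square norm_mult)
    then show ?thesis
      using C(1) by (cases "x = 0") simp_all
  qed
  then show ?thesis
    using C(1) that by blast
qed

end

lemma sum_eq_single:
  assumes "finite I" "j \<in> I" "\<And>i. i \<in> I \<Longrightarrow> i \<noteq> j \<Longrightarrow> f i = 0"
  shows "sum f I = f j"
  using sum.remove[OF assms(1,2), of f] assms(3) by simp

lemma bounded_ops_comp:
  "S \<in> bounded_ops H2 H3 \<Longrightarrow> T \<in> bounded_ops H1 H2 \<Longrightarrow> S \<circ> T \<in> bounded_ops H1 H3"
  using bounded_linear_compose[of S T]
  by (auto simp: bounded_ops_def o_def dest: Vector_Spaces.linear_compose)

context hilbert_space
begin

lemma hadjoint_eq_self_iff: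
  assumes "T \<in> bounded_ops H H"
  shows "hadjoint H H T = T \<longleftrightarrow> (\<forall>x y. hinner H (T x) y = hinner H x (T y))"
proof -
  interpret hilbert_space_pair H H ..
  show ?thesis
    using hinner_hadjoint[OF assms] hadjoint_eqI[OF assms, of T] by metis
qed

end

context hilbert_space_pair
begin

lemma bounded_ops_sum:
  assumes "finite I" "\<And>i. i \<in> I \<Longrightarrow> T i \<in> bounded_ops H1 H2"
  shows "(\<lambda>x. \<Sum>i\<in>I. T i x) \<in> bounded_ops H1 H2"
  using assms by (auto simp: bounded_ops_iff H2.scale_sum_right intro: bounded_linear_sum)

subsection \<open>Generalized inverses\<close>

lemma is_134_inverse_iff:
  assumes "A \<in> bounded_ops H1 H2"
  shows "is_134_inverse H1 H2 A X \<longleftrightarrow> X \<in> bounded_ops H2 H1 \<and>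
    (\<forall>x. A (X (A x)) = A x) \<and>
    (\<forall>y y'. hinner H2 (A (X y)) y' = hinner H2 y (A (X y'))) \<and>
    (\<forall>x x'. hinner H1 (X (A x)) x' = hinner H1 x (X (A x')))"
proof (cases "X \<in> bounded_ops H2 H1")
  case True
  then show ?thesis
    using H2.hadjoint_eq_self_iff[OF bounded_ops_comp[OF assms True]]
      H1.hadjoint_eq_self_iff[OF bounded_ops_comp[OF True assms]]
    by (simp add: is_134_inverse_def fun_eq_iff)
qed (simp add: is_134_inverse_def)

text \<open>The range of \<open>A\<close> is the fixed point set of the continuous map
  \<open>A \<circ> X\<close>.\<close>

lemma closed_range_inner_inverse:
  assumes "A \<in> bounded_ops H1 H2" "X \<in> bounded_ops H2 H1" "\<And>x. A (X (A x)) = A x"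
  shows "A \<in> closed_range_ops H1 H2"
proof -
  have "continuous_on UNIV (A \<circ> X)"
    using bounded_ops_comp[OF assms(1,2)] unfolding bounded_ops_def
    by (blast intro: linear_continuous_on)
  then have "closed {y. (A \<circ> X) y = y}"
    by (intro closed_Collect_eq continuous_on_id)
  moreover have "{y. (A \<circ> X) y = y} = range A"
    using assms(3) by (auto intro: rangeI) (metis rangeI)
  ultimately show ?thesis
    using assms(1) by (simp add: closed_range_ops_def)
qed

text \<open>The closed range of \<open>X\<close> comes from \<open>XAX = X\<close>, by the preceding
  criterion with the two operators exchanged.\<close>

lemma is_MP_inverse_iff:
  assumes "A \<in> bounded_ops H1 H2"
  shows "is_MP_inverse H1 H2 A X \<longleftrightarrow> is_134_inverse H1 H2 A X \<and> (\<forall>y. X (A (X y)) = X y)"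
proof -
  interpret rev: hilbert_space_pair H2 H1 ..
  show ?thesis
    using rev.closed_range_inner_inverse[OF _ assms, of X]
    by (auto simp: is_MP_inverse_def is_134_inverse_def closed_range_ops_def fun_eq_iff)
qed

lemma is_MP_inverseD:
  assumes "A \<in> bounded_ops H1 H2" and "is_MP_inverse H1 H2 A X"
  shows "X \<in> bounded_ops H2 H1" "A (X (A x)) = A x" "X (A (X y)) = X y"
    and "hinner H2 (A (X y)) y' = hinner H2 y (A (X y'))"
    and "hinner H1 (X (A x)) x' = hinner H1 x (X (A x'))"
  using assms(2) unfolding is_MP_inverse_iff[OF assms(1)] is_134_inverse_iff[OF assms(1)]
  by blast+

text \<open>Symmetry reverses the product \<open>AYAX\<close> into \<open>AXAY\<close>, which
  collapses to \<open>AY\<close>; hence \<open>AX = AY\<close>, and likewise \<open>XA = YA\<close>.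
  Then \<open>X = XAX = XAY = YAY = Y\<close>.\<close>

lemma is_MP_inverse_unique:
  assumes A: "A \<in> bounded_ops H1 H2"
    and X: "is_MP_inverse H1 H2 A X" and Y: "is_MP_inverse H1 H2 A Y"
  shows "X = Y"
proof -
  note X = is_MP_inverseD[OF A X]
  note Y = is_MP_inverseD[OF A Y]
  have AX: "A (X y) = A (Y y)" for y
  proof (rule H2.hinner_left_eqI)
    fix z
    have "hinner H2 (A (X y)) z = hinner H2 (A (Y (A (X y)))) z"
      by (simp only: Y(2))
    also have "\<dots> = hinner H2 y (A (X (A (Y z))))"
      by (simp only: X(4) Y(4))
    also have "\<dots> = hinner H2 (A (Y y)) z"
      by (simp only: X(2) Y(4))
    finally show "hinner H2 (A (X y)) z = hinner H2 (A (Y y)) z" .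
  qed
  have XA: "X (A x) = Y (A x)" for x
  proof (rule H1.hinner_left_eqI)
    fix z
    have "hinner H1 (X (A x)) z = hinner H1 (X (A (Y (A x)))) z"
      by (simp only: Y(2))
    also have "\<dots> = hinner H1 x (Y (A (X (A z))))"
      by (simp only: X(5) Y(5))
    also have "\<dots> = hinner H1 (Y (A x)) z"
      by (simp only: X(2) Y(5))
    finally show "hinner H1 (X (A x)) z = hinner H1 (Y (A x)) z" .
  qed
  show ?thesis
  proof
    fix y
    have "X y = X (A (X y))" by (simp only: X(3))
    also have "\<dots> = Y (A (Y y))" by (simp add: AX XA)
    also have "\<dots> = Y y" by (simp only: Y(3))
    finally show "X y = Y y" .
  qed
qed

lemma is_MP_inverse_exists:
  assumes "A \<in> closed_range_ops H1 H2"
  obtains X where "is_MP_inverse H1 H2 A X"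
proof -
  interpret rev: hilbert_space_pair H2 H1 ..
  have A: "A \<in> bounded_ops H1 H2" and clR: "closed (range A)"
    using assms by (auto simp: closed_range_ops_def)
  interpret A: bounded_linear A
    by (rule bounded_opsD(2)[OF A])
  have R: "H2.subspace (range A)"
    by (rule subspace_range[OF A H1.subspace_UNIV])
  have N: "H1.subspace {n. A n = 0}"
    by (auto simp: H1.subspace_def A.zero A.add bounded_opsD(1)[OF A])
  have clN: "closed {n. A n = 0}"
    by (intro closed_Collect_eq continuous_intros A.continuous_on)
  obtain C where C: "0 \<le> C"
    "\<And>x. (\<And>n. A n = 0 \<Longrightarrow> hinner H1 x n = 0) \<Longrightarrow> norm x \<le> C * norm (A x)"
    using bounded_below_on_orthogonal_null_space[OF assms] by blast
  \<comment> \<open>\<open>X y\<close> is the least squares solution of \<open>A x = y\<close> orthogonal to the null space of \<open>A\<close>.\<close>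
  define G where "G y x \<longleftrightarrow>
    (\<forall>n. A n = 0 \<longrightarrow> hinner H1 x n = 0) \<and> (\<forall>u. hinner H2 (A x - y) (A u) = 0)" for y x
  have bound: "norm x \<le> norm y * C" if "G y x" for y x
  proof -
    have "hinner H2 (A x - y) (A x) = 0"
      using that by (simp add: G_def)
    then have "hinner H2 (A x) (y - A x) = 0"
      using H2.hinner_eq_0_commute[of "A x - y"] by (simp add: H2.hinner_diff_right)
    then have "(norm (A x))\<^sup>2 \<le> (norm y)\<^sup>2"
      using H2.pythagoras[of "A x" "y - A x"] by simp
    then have "norm (A x) \<le> norm y"
      by simp
    then have "C * norm (A x) \<le> C * norm y"
      using C(1) by (rule mult_left_mono)
    moreover have "norm x \<le> C * norm (A x)"
      using that by (intro C(2)) (simp add: G_def)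
    ultimately show ?thesis by (simp add: mult.commute)
  qed
  have total: "\<exists>x. G y x" for y
  proof -
    \<comment> \<open>Closedness of the range makes \<open>y\<close> projectable onto it as
      \<open>A u\<close>. Removing the null space component \<open>m\<close> of \<open>u\<close>
      leaves \<open>A u\<close> unchanged and gives the required orthogonality.\<close>
    obtain u where u: "\<And>z. z \<in> range A \<Longrightarrow> hinner H2 (y - A u) z = 0"
      using H2.projection[OF R clR] by (metis rangeE)
    obtain m where m: "A m = 0" "\<And>n. A n = 0 \<Longrightarrow> hinner H1 (u - m) n = 0"
      using H1.projection[OF N clN, of u] by auto
    have "hinner H2 (A (u - m) - y) (A v) = 0" for v
      using u[of "A v"] m(1) by (simp add: A.diff H2.hinner_diff_left)
    then show ?thesis
      using m(2) by (auto simp: G_def)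
  qed
  have scale: "G (hscale H2 c y) (hscale H1 c x)" if "G y x" for c y x
  proof -
    have "A (hscale H1 c x) - hscale H2 c y = hscale H2 c (A x - y)"
      by (simp add: bounded_opsD(1)[OF A] H2.scale_right_diff_distrib)
    then show ?thesis
      using that by (simp add: G_def H1.hinner_hscale_left H2.hinner_hscale_left)
  qed
  have add: "G (y + y') (x + x')" if "G y x" "G y' x'" for y y' x x'
    using that
    by (auto simp: G_def A.add H1.hinner_add_left H2.hinner_add_left H2.hinner_diff_left
        algebra_simps)
  obtain X where X: "X \<in> bounded_ops H2 H1" and G: "\<And>y. G y (X y)"
    using rev.bounded_op_from_graph[of G C] total add scale bound by blast
  interpret X: bounded_linear X
    by (rule rev.bounded_opsD(2)[OF X])
  have perp: "hinner H1 (X y) n = 0" if "A n = 0" for y n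
    using G that by (simp add: G_def)
  have AXy: "hinner H2 (A (X y)) (A u) = hinner H2 y (A u)" for y u
    using G[of y] by (simp add: G_def H2.hinner_diff_left)
  have AXA: "A (X (A x)) = A x" for x
  proof -
    have "hinner H2 (A (X (A x) - x)) (A (X (A x) - x)) = 0"
      by (simp only: A.diff H2.hinner_diff_left H2.hinner_diff_right AXy) simp
    then show ?thesis
      by (simp add: H2.hinner_self_eq_0 A.diff)
  qed
  have XAX: "X (A (X y)) = X y" for y
  proof -
    \<comment> \<open>The difference lies in the null space of \<open>A\<close>, yet both of its
      terms are orthogonal to that space, so it is orthogonal to itself.\<close>
    have "A (X (A (X y)) - X y) = 0"
      by (simp add: A.diff AXA)
    then have "hinner H1 (X (A (X y)) - X y) (X (A (X y)) - X y) = 0"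
      by (simp only: H1.hinner_diff_left perp diff_self)
    then show ?thesis
      by (simp add: H1.hinner_self_eq_0)
  qed
  have "hinner H2 (A (X y)) y' = hinner H2 y (A (X y'))" for y y'
    by (metis AXy H2.hinner_commute)
  moreover have "hinner H1 (X (A x)) x' = hinner H1 x (X (A x'))" for x x'
  proof -
    \<comment> \<open>Values of \<open>X\<close> are orthogonal to the null space, which contains
      these differences. Both sides of the claim thus equal the pairing of \<open>X (A x)\<close>
      with \<open>X (A x')\<close>.\<close>
    have "hinner H1 (X (A x)) (X (A x') - x') = 0" "hinner H1 (X (A x')) (X (A x) - x) = 0"
      by (simp_all add: perp A.diff AXA)
    then show ?thesis
      by (metis H1.hinner_commute H1.hinner_diff_right right_minus_eq)
  qed
  ultimately have "is_MP_inverse H1 H2 A X"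
    by (simp add: is_MP_inverse_iff[OF A] is_134_inverse_iff[OF A] X AXA XAX)
  then show ?thesis by (rule that)
qed

section \<open>Moore-Penrose inverses of orthogonal families\<close>

text \<open>Since \<open>XA\<close> is self-adjoint, \<open>X = (XA)X\<close> factors as the adjoint
  of \<open>A\<close>, after the adjoint of \<open>X\<close>, after \<open>X\<close>.\<close>

lemma range_MP_inverse_subset:
  assumes A: "A \<in> bounded_ops H1 H2" and "is_MP_inverse H1 H2 A X"
  shows "range X \<subseteq> range (hadjoint H1 H2 A)"
proof
  interpret rev: hilbert_space_pair H2 H1 ..
  note X = is_MP_inverseD[OF assms]
  fix x assume "x \<in> range X"
  then obtain y where y: "x = X y" by blast
  have "x = hadjoint H1 H2 A (hadjoint H2 H1 X x)"
  proof (rule H1.hinner_right_eqI)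
    fix v
    have "hinner H1 v x = hinner H1 v (X (A (X y)))"
      by (simp only: X(3) y)
    also have "\<dots> = hinner H1 (X (A v)) (X y)"
      by (simp only: X(5))
    also have "\<dots> = hinner H1 v (hadjoint H1 H2 A (hadjoint H2 H1 X (X y)))"
      by (simp only: rev.hinner_hadjoint[OF X(1)] hinner_hadjoint[OF A])
    finally show "hinner H1 v x = hinner H1 v (hadjoint H1 H2 A (hadjoint H2 H1 X x))"
      by (simp add: y)
  qed
  then show "x \<in> range (hadjoint H1 H2 A)" by blast
qed

text \<open>If the adjoint of \<open>A\<close> kills \<open>y\<close>, symmetry of \<open>AX\<close>
  makes \<open>A (X y)\<close> orthogonal to everything, and \<open>X = XAX\<close> gives
  \<open>X y = 0\<close>.\<close>

lemma null_space_adjoint_subset_MP_inverse: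
  assumes A: "A \<in> bounded_ops H1 H2" and "is_MP_inverse H1 H2 A X"
  shows "null_space (hadjoint H1 H2 A) \<subseteq> null_space X"
proof
  interpret rev: hilbert_space_pair H2 H1 ..
  note X = is_MP_inverseD[OF assms]
  interpret X: bounded_linear X
    by (rule rev.bounded_opsD(2)[OF X(1)])
  fix y assume "y \<in> null_space (hadjoint H1 H2 A)"
  then have y: "hadjoint H1 H2 A y = 0"
    by (simp add: null_space_def)
  have "hinner H2 w (A (X y)) = 0" for w
  proof -
    have "hinner H2 w (A (X y)) = hinner H2 (A (X w)) y"
      by (simp only: X(4))
    also have "\<dots> = 0"
      by (simp add: hinner_hadjoint[OF A] y)
    finally show ?thesis .
  qed
  then have "A (X y) = 0"
    using H2.hinner_self_eq_0 by blast
  then have "X y = 0"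
    using X(3)[of y] by (simp add: X.zero)
  then show "y \<in> null_space X"
    by (simp add: null_space_def)
qed

lemma MP_inverse_orthogonal_sum:
  assumes "finite I" "\<And>i. i \<in> I \<Longrightarrow> A i \<in> bounded_ops H1 H2"
    and "\<And>i. i \<in> I \<Longrightarrow> is_MP_inverse H1 H2 (A i) (X i)"
    and ran: "\<And>i j. i \<in> I \<Longrightarrow> j \<in> I \<Longrightarrow> i \<noteq> j \<Longrightarrow> range (A i) \<subseteq> null_space (hadjoint H1 H2 (A j))"
    and ran_adj: "\<And>i j. i \<in> I \<Longrightarrow> j \<in> I \<Longrightarrow> i \<noteq> j \<Longrightarrow> range (hadjoint H1 H2 (A i)) \<subseteq> null_space (A j)"
  shows "is_MP_inverse H1 H2 (\<lambda>x. \<Sum>i\<in>I. A i x) (\<lambda>y. \<Sum>i\<in>I. X i y)"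
    and "i \<in> I \<Longrightarrow> is_134_inverse H1 H2 (A i) (\<lambda>y. \<Sum>i\<in>I. X i y)"
proof -
  interpret rev: hilbert_space_pair H2 H1 ..
  define SA where "SA = (\<lambda>x. \<Sum>i\<in>I. A i x)"
  define SX where "SX = (\<lambda>y. \<Sum>i\<in>I. X i y)"
  have X: "X i \<in> bounded_ops H2 H1" "A i (X i (A i x)) = A i x" "X i (A i (X i y)) = X i y"
      "hinner H2 (A i (X i y)) y' = hinner H2 y (A i (X i y'))"
      "hinner H1 (X i (A i x)) x' = hinner H1 x (X i (A i x'))"
    if "i \<in> I" for i x x' y y'
    by (rule is_MP_inverseD[OF assms(2)[OF that] assms(3)[OF that]])+
  have A_linear: "bounded_linear (A i)" if "i \<in> I" for i
    by (rule bounded_opsD(2)[OF assms(2)[OF that]])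
  have X_linear: "bounded_linear (X i)" if "i \<in> I" for i
    by (rule rev.bounded_opsD(2)[OF X(1)[OF that]])
  have SA: "SA \<in> bounded_ops H1 H2"
    unfolding SA_def using assms(1,2) by (rule bounded_ops_sum)
  have SX: "SX \<in> bounded_ops H2 H1"
    unfolding SX_def using assms(1) X(1) by (rule rev.bounded_ops_sum)
  have AX0: "A j (X i y) = 0" if "i \<in> I" "j \<in> I" "i \<noteq> j" for i j y
    using range_MP_inverse_subset[OF assms(2,3), of i] ran_adj[OF that] that(1)
    by (auto simp: null_space_def)
  have XA0: "X j (A i x) = 0" if "i \<in> I" "j \<in> I" "i \<noteq> j" for i j x
    using null_space_adjoint_subset_MP_inverse[OF assms(2,3), of j] ran[OF that] that(2)
    by (auto simp: null_space_def)
  \<comment> \<open>Only the summand with index \<open>j\<close> survives, so both products of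
    \<open>SA\<close> and \<open>SX\<close> become sums of the individual projections and the
    equations hold term by term.\<close>
  have A_SX: "A j (SX y) = A j (X j y)" if "j \<in> I" for j y
    unfolding SX_def linear_sum[OF bounded_linear.linear[OF A_linear[OF that]]]
    using that AX0 by (intro sum_eq_single assms(1)) auto
  have X_SA: "X j (SA x) = X j (A j x)" if "j \<in> I" for j x
    unfolding SA_def linear_sum[OF bounded_linear.linear[OF X_linear[OF that]]]
    using that XA0 by (intro sum_eq_single assms(1)) auto
  have SX_A: "SX (A j x) = X j (A j x)" if "j \<in> I" for j x
    unfolding SX_def using that XA0 by (intro sum_eq_single assms(1)) auto
  have SA_SX: "SA (SX y) = (\<Sum>i\<in>I. A i (X i y))" for y
    unfolding SA_def by (simp add: A_SX)
  have SX_SA: "SX (SA x) = (\<Sum>i\<in>I. X i (A i x))" for x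
    unfolding SX_def by (simp add: X_SA)
  have "SA (SX (SA x)) = SA x" for x
    unfolding SA_SX by (simp add: X_SA X(2)) (simp add: SA_def)
  moreover have "SX (SA (SX y)) = SX y" for y
    unfolding SX_SA by (simp add: A_SX X(3)) (simp add: SX_def)
  moreover have "hinner H2 (SA (SX y)) y' = hinner H2 y (SA (SX y'))" for y y'
    unfolding SA_SX by (simp add: H2.hinner_sum_left H2.hinner_sum_right X(4))
  moreover have "hinner H1 (SX (SA x)) x' = hinner H1 x (SX (SA x'))" for x x'
    unfolding SX_SA by (simp add: H1.hinner_sum_left H1.hinner_sum_right X(5))
  ultimately have "is_MP_inverse H1 H2 SA SX"
    unfolding is_MP_inverse_iff[OF SA] is_134_inverse_iff[OF SA] using SX by blast
  then show "is_MP_inverse H1 H2 (\<lambda>x. \<Sum>i\<in>I. A i x) (\<lambda>y. \<Sum>i\<in>I. X i y)"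
    by (simp add: SA_def SX_def)
  show "is_134_inverse H1 H2 (A i) (\<lambda>y. \<Sum>i\<in>I. X i y)" if "i \<in> I"
    unfolding SX_def[symmetric] is_134_inverse_iff[OF assms(2)[OF that]]
    using that SX by (auto simp: A_SX SX_A X)
qed

end

text \<open>\<open>MP_inverse\<close> is a definite description, so unique existence is asserted
  alongside to give the last conjunct its intended meaning.\<close>

theorem corollary2p2:
  fixes H1 :: "('f::real_or_complex, 'a::banach) hilbert"
    and H2 :: "('f, 'b::banach) hilbert"
    and A :: "nat \<Rightarrow> 'a \<Rightarrow> 'b"
    and K :: nat
  assumes "hilbert_space H1" and "hilbert_space H2"
    and "K \<ge> 1"
    and "\<And>k. k \<in> {1..K} \<Longrightarrow> A k \<in> closed_range_ops H1 H2"
    and "\<And>k k'. k \<in> {1..K} \<Longrightarrow> k' \<in> {1..K} \<Longrightarrow> k \<noteq> k' \<Longrightarrow>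
          range (A k) \<subseteq> null_space (hadjoint H1 H2 (A k')) \<and>
          range (hadjoint H1 H2 (A k)) \<subseteq> null_space (A k')"
  shows "(\<lambda>x. \<Sum>k=1..K. A k x) \<in> closed_range_ops H1 H2 \<and>
    (\<exists>!X. is_MP_inverse H1 H2 (\<lambda>x. \<Sum>k=1..K. A k x) X) \<and>
    (\<forall>k0\<in>{1..K}. is_134_inverse H1 H2 (A k0) (MP_inverse H1 H2 (\<lambda>x. \<Sum>k=1..K. A k x)))"
proof -
  interpret hilbert_space_pair H1 H2
    using assms(1,2) by (rule hilbert_space_pair.intro)
  have A: "A k \<in> bounded_ops H1 H2" if "k \<in> {1..K}" for k
    using assms(4)[OF that] by (simp add: closed_range_ops_def)
  have "\<forall>k\<in>{1..K}. \<exists>X. is_MP_inverse H1 H2 (A k) X"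
    using is_MP_inverse_exists[OF assms(4)] by blast
  then obtain X where X: "\<And>k. k \<in> {1..K} \<Longrightarrow> is_MP_inverse H1 H2 (A k) (X k)"
    by metis
  define SA where "SA = (\<lambda>x. \<Sum>k=1..K. A k x)"
  define SX where "SX = (\<lambda>y. \<Sum>k=1..K. X k y)"
  have SA: "SA \<in> bounded_ops H1 H2"
    unfolding SA_def using A by (intro bounded_ops_sum) auto
  have MP: "is_MP_inverse H1 H2 SA SX"
    unfolding SA_def SX_def using assms(5) by (intro MP_inverse_orthogonal_sum(1) A X) auto
  have inv: "is_134_inverse H1 H2 (A k) SX" if "k \<in> {1..K}" for k
    unfolding SX_def using assms(5) that
    by (intro MP_inverse_orthogonal_sum(2)[where A = A] A X) auto
  have "SA \<in> closed_range_ops H1 H2"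
    \<comment> \<open>The explicit inner inverse \<open>SX\<close> shows that the range of the sum
      is closed.\<close>
    by (rule closed_range_inner_inverse[OF SA is_MP_inverseD(1,2)[OF SA MP]])
  moreover have unique: "Y = SX" if "is_MP_inverse H1 H2 SA Y" for Y
    by (rule is_MP_inverse_unique[OF SA that MP])
  then have "\<exists>!X. is_MP_inverse H1 H2 SA X"
    using MP by (intro ex1I[where a = SX])
  moreover have "MP_inverse H1 H2 SA = SX"
    unfolding MP_inverse_def by (rule the_equality[where P = "is_MP_inverse H1 H2 SA", OF MP unique])
  then have "\<forall>k\<in>{1..K}. is_134_inverse H1 H2 (A k) (MP_inverse H1 H2 SA)"
    using inv by simp
  ultimately show ?thesis
    unfolding SA_def by (intro conjI)
qed

end
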